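(* Let $n\geq 0$ be a natural number, let $X$ be a finite set, and let $<_1,<_2,\ldots,<_{n+1}$ be $n+1$ linear orders on $X$. Let $$\mathcal{F} = \left\{A\subset X : \exists\, s_1,\ldots,s_{n+1}\in X \text{ such that } A = \{t\in X : t\leq_1 s_1, \ldots, t \leq_{n+1} s_{n+1}\}\right\}.$$ Then $\mathfrak{fr}(\mathcal{F}) \leq n$.
   Context: For a set $Z$, $[Z]^{<\omega}$ denotes the family of all finite subsets of $Z$. The cardinal $\aleph_n$ is identified with the set of all ordinals below the initial ordinal $\omega_n$. For a finite family $\mathcal{F}$ of finite sets, $\mathfrak{fr}(\mathcal{F})$ is the least natural number $n\geq 0$ such that for every function $S:[\aleph_n]^{<\omega}\to[\aleph_n]^{<\omega}$ there exist $Y\subset\aleph_n$ and a bijection $u:\bigcup\mathcal{F}\to Y$ such that $S(u(A))\cap Y\subset u(A)$ for all $A\in\mathcal{F}$, where $u(A)=\{u(a):a\in A\}$ (such an $n$ always exists). *)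

theory Defs
  imports Main "HOL-Library.FuncSet" "HOL-Library.Extended_Nat"
begin

unbundle cardinal_syntax

text \<open>
  The sets of cardinality \<open>\<aleph>\<^sub>n\<close>.  HOL has no type containing sets of cardinality \<open>\<aleph>\<^sub>n\<close> for all
  \<open>n\<close> at once, and \<^const>\<open>cardSuc\<close> raises the type; since every cardinal below that of a set is
  the cardinality of one of its subsets, the recursion can be carried out within a single type.
\<close>

primrec aleph_set :: "nat \<Rightarrow> 'k set \<Rightarrow> bool" where
  "aleph_set 0 K \<longleftrightarrow> |K| =o natLeq"
| "aleph_set (Suc n) K \<longleftrightarrow> (\<exists>L::'k set. aleph_set n L \<and> |K| =o cardSuc |L| )"

text \<open>
  The set \<open>K\<close> plays the role of \<open>\<aleph>\<^sub>n\<close>, that is, of the set of all ordinals below \<open>\<omega>\<^sub>n\<close>.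
\<close>

definition has_free_images :: "'a set set \<Rightarrow> 'k set \<Rightarrow> bool" where
  "has_free_images \<F> K \<longleftrightarrow>
     (\<forall>S \<in> Fpow K \<rightarrow> Fpow K.
        \<exists>Y u. Y \<subseteq> K \<and> bij_betw u (\<Union>\<F>) Y \<and> (\<forall>A\<in>\<F>. S (u ` A) \<inter> Y \<subseteq> u ` A))"

text \<open>
  The least \<open>n\<close> that works for \<open>\<aleph>\<^sub>n\<close>, where only those \<open>\<aleph>\<^sub>n\<close> are considered which are represented
  by a set over the type \<open>'k\<close>; the value is \<open>\<infinity>\<close> if none of these works, so that no junk value
  can satisfy an upper bound.  As soon as \<open>'k\<close> has a subset of cardinality \<open>\<aleph>\<^sub>n\<close>, the truth value of
  \<open>fr TYPE('k) \<F> \<le> enat n\<close> no longer depends on \<open>'k\<close>, see \<open>fr_le_type_independent\<close> below.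
  For every \<open>n\<close> there are such types: iterate \<open>aleph_set_Suc_power_type\<close>, starting from \<^typ>\<open>nat\<close>.
\<close>

definition fr :: "'k itself \<Rightarrow> 'a set set \<Rightarrow> enat" where
  "fr (_ :: 'k itself) \<F> =
     Inf {enat n | n. \<exists>K::'k set. aleph_set n K \<and> has_free_images \<F> K}"

lemma aleph_set_unique:
  fixes K :: "'k set" and L :: "'l set"
  assumes "aleph_set n K" "aleph_set n L"
  shows "|K| =o |L|"
  using assms
proof (induction n arbitrary: K L)
  case 0
  then show ?case
    using ordIso_transitive ordIso_symmetric by fastforce
next
  case (Suc n)
  then obtain K' :: "'k set" and L' :: "'l set"
    where 1: "aleph_set n K'" "|K| =o cardSuc |K'|" "aleph_set n L'" "|L| =o cardSuc |L'|"
    by auto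
  have "cardSuc |K'| =o cardSuc |L'|"
    using Suc.IH[OF 1(1,3)]
    by (simp add: cardSuc_invar_ordIso[OF card_of_Card_order card_of_Card_order])
  then show ?case
    by (rule ordIso_transitive[OF ordIso_transitive[OF 1(2)] ordIso_symmetric[OF 1(4)]])
qed

lemma aleph_set_cong:
  fixes K :: "'k set" and L :: "'l set"
  assumes "aleph_set n K" "|L| =o |K|"
  shows "aleph_set n L"
  using assms
proof (induction n arbitrary: K L)
  case 0
  then show ?case
    using ordIso_transitive by auto
next
  case (Suc n)
  then obtain K' :: "'k set" where K': "aleph_set n K'" "|K| =o cardSuc |K'|"
    by auto
  then have "|K'| <o |K|"
    using cardSuc_greater[OF card_of_Card_order] ordIso_symmetric ordLess_ordIso_trans by blast
  then have "|K'| \<le>o |L|"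
    using Suc.prems(2) ordIso_symmetric ordLess_ordIso_trans ordLess_imp_ordLeq by blast
  then obtain f where f: "inj_on f K'" "f ` K' \<subseteq> L"
    unfolding card_of_ordLeq[symmetric] by blast
  have iso: "|f ` K'| =o |K'|"
    using f(1) card_of_ordIsoI[of f K' "f ` K'"] ordIso_symmetric
    by (auto simp: bij_betw_def)
  then have "aleph_set n (f ` K')"
    using Suc.IH K'(1) by blast
  moreover have "cardSuc |K'| =o cardSuc |f ` K'|"
    using ordIso_symmetric[OF iso]
    by (simp add: cardSuc_invar_ordIso[OF card_of_Card_order card_of_Card_order])
  then have "|L| =o cardSuc |f ` K'|"
    by (rule ordIso_transitive[OF ordIso_transitive[OF Suc.prems(2) K'(2)]])
  ultimately show ?case
    by auto
qed

lemma aleph_set_downward: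
  fixes K :: "'k set"
  assumes "aleph_set n K" "m \<le> n"
  shows "\<exists>L::'k set. aleph_set m L"
  using assms
proof (induction n arbitrary: K)
  case (Suc n)
  then show ?case
    by (cases "m = Suc n") auto
qed auto

lemma aleph_set_0_nat: "aleph_set 0 (UNIV :: nat set)"
  using card_of_nat by simp

lemma aleph_set_Suc_power_type:
  fixes K :: "'k set"
  assumes "aleph_set n K"
  shows "\<exists>L::'k set set. aleph_set (Suc n) L"
proof -
  define K' where "K' = (\<lambda>x. {x}) ` K"
  have iso: "|K'| =o |K|"
    using card_of_ordIsoI[of "\<lambda>x. {x}" K K'] ordIso_symmetric
    unfolding K'_def by (auto simp: bij_betw_def)
  have "cardSuc |K| =o cardSuc |K'|"
    using iso cardSuc_invar_ordIso[OF card_of_Card_order card_of_Card_order]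
      ordIso_symmetric by blast
  then have "|Field (cardSuc |K| )| =o cardSuc |K'|"
    using card_of_Field_ordIso[OF cardSuc_Card_order[OF card_of_Card_order]]
      ordIso_transitive by blast
  then show ?thesis
    using aleph_set_cong[OF assms iso] by auto
qed

lemma has_free_images_cong:
  fixes K :: "'k set" and L :: "'l set"
  assumes free: "has_free_images \<F> K" and iso: "|K| =o |L|"
  shows "has_free_images \<F> L"
  unfolding has_free_images_def
proof
  fix S assume S: "S \<in> Fpow L \<rightarrow> Fpow L"
  obtain f where f: "bij_betw f K L"
    using iso card_of_ordIso by blast
  define g where "g = the_inv_into K f"
  have g: "bij_betw g L K"
    unfolding g_def using f by (rule bij_betw_the_inv_into)
  have fg: "f (g y) = y" if "y \<in> L" for y
    unfolding g_def using f that by (simp add: f_the_inv_into_f_bij_betw)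
  have gf: "g (f x) = x" if "x \<in> K" for x
    unfolding g_def using f that by (simp add: bij_betw_def the_inv_into_f_f)
  define T where "T B = g ` S (f ` B)" for B
  have fF: "f ` B \<in> Fpow L" if "B \<in> Fpow K" for B
    using that f by (auto simp: Fpow_def bij_betw_def)
  have "T \<in> Fpow K \<rightarrow> Fpow K"
  proof
    fix B assume "B \<in> Fpow K"
    then have "S (f ` B) \<in> Fpow L"
      using fF S by blast
    then show "T B \<in> Fpow K"
      using g by (auto simp: T_def Fpow_def bij_betw_def)
  qed
  then have "\<exists>Y u. Y \<subseteq> K \<and> bij_betw u (\<Union>\<F>) Y \<and> (\<forall>A\<in>\<F>. T (u ` A) \<inter> Y \<subseteq> u ` A)"
    using free unfolding has_free_images_def by (rule bspec[rotated])
  then obtain Y u where Y: "Y \<subseteq> K" and u: "bij_betw u (\<Union>\<F>) Y"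
    and free': "\<forall>A\<in>\<F>. T (u ` A) \<inter> Y \<subseteq> u ` A"
    by (elim exE conjE)
  have "bij_betw f Y (f ` Y)"
    using f Y by (rule bij_betw_subset) simp
  with u have "bij_betw (f \<circ> u) (\<Union>\<F>) (f ` Y)"
    by (rule bij_betw_trans)
  moreover have "f ` Y \<subseteq> L"
    using f Y by (auto simp: bij_betw_def)
  moreover have "S ((f \<circ> u) ` A) \<inter> f ` Y \<subseteq> (f \<circ> u) ` A" if "A \<in> \<F>" for A
  proof
    fix z assume z: "z \<in> S ((f \<circ> u) ` A) \<inter> f ` Y"
    then obtain y where y: "y \<in> Y" "z = f y"
      by auto
    have "g z \<in> T (u ` A)"
      using z unfolding T_def image_comp by (intro imageI) (rule IntD1)
    moreover have "g z = y"
      using y Y gf by auto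
    ultimately have "y \<in> u ` A"
      using bspec[OF free' that] y by auto
    then show "z \<in> (f \<circ> u) ` A"
      using y by auto
  qed
  ultimately show "\<exists>Y u. Y \<subseteq> L \<and> bij_betw u (\<Union>\<F>) Y \<and> (\<forall>A\<in>\<F>. S (u ` A) \<inter> Y \<subseteq> u ` A)"
    by (intro exI[of _ "f ` Y"] exI[of _ "f \<circ> u"] conjI ballI)
qed

lemma fr_le_iff:
  "fr TYPE('k) \<F> \<le> enat n \<longleftrightarrow>
     (\<exists>m\<le>n. \<exists>K::'k set. aleph_set m K \<and> has_free_images \<F> K)"
proof -
  let ?M = "{enat n | n. \<exists>K::'k set. aleph_set n K \<and> has_free_images \<F> K}"
  show ?thesis
  proof
    assume *: "fr TYPE('k) \<F> \<le> enat n"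
    have "?M \<noteq> {}"
    proof
      assume "?M = {}"
      then have "fr TYPE('k) \<F> = \<infinity>"
        unfolding fr_def by (simp only: Inf_empty top_enat_def)
      with * show False
        by simp
    qed
    then have "Inf ?M \<in> ?M"
      unfolding ex_in_conv[symmetric] by (elim exE) (rule wellorder_InfI)
    then obtain m where m: "Inf ?M = enat m"
      and K: "\<exists>K::'k set. aleph_set m K \<and> has_free_images \<F> K"
      by blast
    have "m \<le> n"
      using * unfolding fr_def m by simp
    with K show "\<exists>m\<le>n. \<exists>K::'k set. aleph_set m K \<and> has_free_images \<F> K"
      by blast
  next
    assume "\<exists>m\<le>n. \<exists>K::'k set. aleph_set m K \<and> has_free_images \<F> K"
    then obtain m where m: "m \<le> n" "enat m \<in> ?M"
      by blast
    then have "Inf ?M \<le> enat m"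
      by (intro Inf_lower)
    also have "enat m \<le> enat n"
      using m by simp
    finally show "fr TYPE('k) \<F> \<le> enat n"
      by (simp add: fr_def)
  qed
qed

lemma fr_le_type_transfer:
  fixes K :: "'k set"
  assumes K: "aleph_set n K" and le: "fr TYPE('l) \<F> \<le> enat n"
  shows "fr TYPE('k) \<F> \<le> enat n"
proof -
  obtain m and M :: "'l set"
    where m: "m \<le> n" and M: "aleph_set m M" "has_free_images \<F> M"
    using le unfolding fr_le_iff by blast
  obtain N :: "'k set" where N: "aleph_set m N"
    using aleph_set_downward[OF K m] by blast
  show ?thesis
    using m N has_free_images_cong[OF M(2) aleph_set_unique[OF M(1) N]]
    unfolding fr_le_iff by blast
qed

lemma fr_le_type_independent:
  fixes K :: "'k set" and L :: "'l set"
  assumes "aleph_set n K" "aleph_set n L"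
  shows "fr TYPE('k) \<F> \<le> enat n \<longleftrightarrow> fr TYPE('l) \<F> \<le> enat n"
  by (intro iffI fr_le_type_transfer[OF assms(1)] fr_le_type_transfer[OF assms(2)])

end

theory Submission
  imports Defs "HOL-Algebra.Free_Abelian_Groups"
begin

text \<open>
  Call a set of the form \<open>{t \<in> X. t \<le>\<^sub>1 s\<^sub>1, \<dots>, t \<le>\<^sub>d s\<^sub>d}\<close> an orthant of the first \<open>d\<close> orders.  We look
  for a map \<open>u : X \<rightarrow> K\<close> such that \<open>u x \<notin> S (u ` A)\<close> whenever \<open>A\<close> is an orthant and \<open>x \<in> X - A\<close>, and
  argue by induction on the number \<open>d\<close> of orders, where \<open>K\<close> sits above a strictly increasing chain of
  \<open>d\<close> cardinals.  For \<open>d = 0\<close> the only orthant is \<open>X\<close> itself, so that any map will do.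

  For the step, let \<open>|L| < |K|\<close>, and let \<open>j\<^sub>x\<close> be the position of \<open>x\<close> in the last order.  If a
  subset of \<open>K\<close> has size less than \<open>|K|\<close>, so has the union of the values of \<open>S\<close> at its finite subsets
  (\<open>card_of_UN_Fpow_ordLess\<close>), so there are injections \<open>\<phi>\<^sub>0, \<phi>\<^sub>1, \<dots>\<close> of \<open>L\<close> into \<open>K\<close> such that the copy
  \<open>\<phi>\<^sub>j ` L\<close> avoids \<open>S C\<close> for every finite subset \<open>C\<close> of the earlier copies (\<open>avoiding_copies\<close>).  The
  element \<open>x\<close> is sent into the copy with number \<open>j\<^sub>x\<close>.  If \<open>x\<close> is above \<open>s\<^sub>d\<^sub>+\<^sub>1\<close> in the last order, then
  \<open>u ` A\<close> lies in the earlier copies, so that \<open>u x \<notin> S (u ` A)\<close>.  If instead \<open>x\<close> violates one of the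
  first \<open>d\<close> inequalities, then \<open>x\<close> is outside the larger orthant that these define, and the induction
  hypothesis applies: we pull \<open>S\<close> back to a function \<open>T\<close> on finite subsets of \<open>L\<close> which collects all copies
  at once, take a map \<open>u' : X \<rightarrow> L\<close> for \<open>T\<close> and the first \<open>d\<close> orders, and put
  \<open>u x = \<phi>\<^sub>j\<^sub>x (u' x)\<close>.

  The cardinal \<open>\<aleph>\<^sub>n\<close> sits above the chain of length \<open>n + 1\<close> formed by \<open>1\<close> and \<open>\<aleph>\<^sub>0, \<dots>, \<aleph>\<^sub>n\<^sub>-\<^sub>1\<close>, which
  is why \<open>n + 1\<close> orders can be handled.
\<close>


section \<open>Small sets and finite subsets\<close>

lemma card_of_UN_Fpow_ordLess:
  fixes U :: "'k set" and S :: "'k set \<Rightarrow> 'k set"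
  assumes K: "infinite (K :: 'k set)" and U: "|U| <o |K|"
    and fin: "\<And>C. C \<in> Fpow U \<Longrightarrow> finite (S C)"
  shows "|\<Union>C\<in>Fpow U. S C| <o |K|"
proof (cases "finite U")
  case True
  then have "finite (Fpow U)"
    by (simp add: finite_subset[OF Fpow_subset_Pow])
  then have "finite (\<Union>C\<in>Fpow U. S C)"
    using fin by (rule finite_UN_I)
  then show ?thesis
    using K finite_ordLess_infinite2 by blast
next
  case False
  then have "|Fpow U| \<le>o |U|"
    using eqpoll_Fpow[of U] unfolding eqpoll_iff_card_of_ordIso by (simp add: ordIso_iff_ordLeq)
  moreover have "|S C| \<le>o |U|" if "C \<in> Fpow U" for C
    using finite_ordLess_infinite2[OF fin[OF that] False] by (rule ordLess_imp_ordLeq)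
  ultimately have "|\<Union>C\<in>Fpow U. S C| \<le>o |U|"
    by (intro card_of_UNION_ordLeq_infinite[OF False] ballI)
  then show ?thesis
    using U ordLeq_ordLess_trans by blast
qed

lemma card_of_UN_images_ordLess:
  fixes \<phi> :: "nat \<Rightarrow> 'k \<Rightarrow> 'k"
  assumes "infinite K" "|L| <o |K|"
  shows "|\<Union>i<j. \<phi> i ` L| <o |K|"
proof (induction j)
  case 0
  then show ?case
    using assms(1) finite_ordLess_infinite2 by auto
next
  case (Suc j)
  have "|\<phi> j ` L| <o |K|"
    using card_of_image assms(2) ordLeq_ordLess_trans by blast
  then show ?case
    using card_of_Un_ordLess_infinite[OF assms(1) _ Suc] by (simp add: lessThan_Suc)
qed

lemma ordLess_complement_embedding:
  assumes "infinite K" "|L| <o |K|" "|W| <o |K|"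
  shows "\<exists>f. inj_on f L \<and> f ` L \<subseteq> K - W"
proof (rule ccontr)
  assume "\<not> ?thesis"
  then have "\<not> |L| \<le>o |K - W|"
    unfolding card_of_ordLeq[symmetric] by blast
  then have "|K - W| <o |L|"
    by (simp add: card_of_Well_order not_ordLeq_iff_ordLess)
  then have "|K - W| <o |K|"
    using assms(2) ordLess_transitive by blast
  then have "|W \<union> (K - W)| <o |K|"
    using assms card_of_Un_ordLess_infinite by blast
  moreover have "|K| \<le>o |W \<union> (K - W)|"
    by (rule card_of_mono1) blast
  ultimately show False
    using not_ordLess_ordLeq by blast
qed

lemma avoiding_copy:
  fixes K :: "'k set"
  assumes K: "infinite K" and L: "|L| <o |K|" and S: "S \<in> Fpow K \<rightarrow> Fpow K"
    and U: "U \<subseteq> K" "|U| <o |K|"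
  shows "\<exists>f. inj_on f L \<and> f ` L \<subseteq> K \<and> (\<forall>C \<in> Fpow U. f ` L \<inter> S C = {})"
proof -
  have "finite (S C)" if "C \<in> Fpow U" for C
  proof -
    have "C \<in> Fpow K"
      using that Fpow_mono[OF U(1)] by (rule subsetD[rotated])
    then have "S C \<in> Fpow K"
      by (rule funcset_mem[OF S])
    then show ?thesis
      by (simp add: Fpow_def)
  qed
  then have "|\<Union>C\<in>Fpow U. S C| <o |K|"
    by (rule card_of_UN_Fpow_ordLess[OF K U(2)])
  then obtain f where "inj_on f L" "f ` L \<subseteq> K - (\<Union>C\<in>Fpow U. S C)"
    using ordLess_complement_embedding[OF K L] by blast
  then show ?thesis
    by (intro exI[of _ f]) blast
qed

text \<open>
  The copies are chosen one after the other: the finitely many earlier ones together have size less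
  than \<open>|K|\<close>, hence so has everything that \<open>S\<close> produces from their finite subsets, and the rest of \<open>K\<close>
  still has room for one more copy of \<open>L\<close>.
\<close>

lemma avoiding_copies:
  fixes K :: "'k set"
  assumes K: "infinite K" and L: "|L| <o |K|" and S: "S \<in> Fpow K \<rightarrow> Fpow K"
  shows "\<exists>\<phi> :: nat \<Rightarrow> 'k \<Rightarrow> 'k. \<forall>j. inj_on (\<phi> j) L \<and> \<phi> j ` L \<subseteq> K \<and>
           (\<forall>C \<in> Fpow (\<Union>i<j. \<phi> i ` L). \<phi> j ` L \<inter> S C = {})"
proof -
  define P where "P \<phi> j f \<longleftrightarrow> inj_on f L \<and> f ` L \<subseteq> K \<and>
    (\<forall>C \<in> Fpow (\<Union>i<j. \<phi> i ` L). f ` L \<inter> S C = {})"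
    for \<phi> :: "nat \<Rightarrow> 'k \<Rightarrow> 'k" and j f
  have "\<exists>\<phi>. \<forall>j. P \<phi> j (\<phi> j)"
  proof (rule dependent_wf_choice[OF wf_less_than])
    fix \<phi> \<psi> :: "nat \<Rightarrow> 'k \<Rightarrow> 'k" and j f
    assume "\<And>i. (i, j) \<in> less_than \<Longrightarrow> \<phi> i = \<psi> i"
    then have "(\<Union>i<j. \<phi> i ` L) = (\<Union>i<j. \<psi> i ` L)"
      by (intro SUP_cong) auto
    then show "P \<phi> j f = P \<psi> j f"
      by (simp only: P_def)
  next
    fix j and \<phi> :: "nat \<Rightarrow> 'k \<Rightarrow> 'k"
    assume "\<And>i. (i, j) \<in> less_than \<Longrightarrow> P \<phi> i (\<phi> i)"
    then have "(\<Union>i<j. \<phi> i ` L) \<subseteq> K"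
      by (intro UN_least) (simp add: P_def)
    then show "\<exists>f. P \<phi> j f"
      unfolding P_def by (rule avoiding_copy[OF K L S _ card_of_UN_images_ordLess[OF K L]])
  qed
  then show ?thesis
    by (simp only: P_def)
qed


section \<open>Chains of cardinals\<close>

text \<open>
  This is all that the induction uses of \<open>\<aleph>\<^sub>n\<close>.  The chain starts with any nonempty set, so that its
  second member may already be \<open>\<aleph>\<^sub>0\<close>.
\<close>

primrec above_chain :: "nat \<Rightarrow> 'k set \<Rightarrow> bool" where
  "above_chain 0 K \<longleftrightarrow> K \<noteq> {}"
| "above_chain (Suc d) K \<longleftrightarrow> infinite K \<and> (\<exists>L::'k set. above_chain d L \<and> |L| <o |K| )"

lemma aleph_set_imp_above_chain:
  assumes "aleph_set n K"
  shows "above_chain (Suc n) K"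
  using assms
proof (induction n arbitrary: K)
  case 0
  then have "|K| =o natLeq"
    by simp
  then have K: "infinite K"
    using infinite_iff_natLeq_ordLeq[of K] by (simp add: ordIso_iff_ordLeq)
  have "|{x}| <o |K|" for x :: 'a
    by (rule finite_ordLess_infinite2[OF _ K]) simp
  then have "\<exists>L::'a set. L \<noteq> {} \<and> |L| <o |K|"
    by blast
  with K show ?case
    by simp
next
  case (Suc n)
  then obtain L :: "'a set" where L: "aleph_set n L" "|K| =o cardSuc |L|"
    by auto
  then have less: "|L| <o |K|"
    using cardSuc_greater[OF card_of_Card_order] ordIso_symmetric ordLess_ordIso_trans by blast
  have chain: "above_chain (Suc n) L"
    using Suc.IH L(1) .
  then have "infinite L"
    by simp
  then have "infinite K"
    by (rule card_of_ordLeq_infinite[OF ordLess_imp_ordLeq[OF less]])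
  with chain less show ?case
    by (subst above_chain.simps(2)) blast
qed


section \<open>Orthants\<close>

definition orthant :: "'a set \<Rightarrow> (nat \<Rightarrow> 'a rel) \<Rightarrow> nat \<Rightarrow> (nat \<Rightarrow> 'a) \<Rightarrow> 'a set" where
  "orthant X r d s = {t \<in> X. \<forall>i\<in>{1..d}. (t, s i) \<in> r i}"

lemma orthant_Suc:
  "orthant X r (Suc d) s = {t \<in> orthant X r d s. (t, s (Suc d)) \<in> r (Suc d)}"
  by (auto simp: orthant_def atLeastAtMostSuc_conv)

lemma linear_order_rank_less:
  assumes X: "finite X" and r: "linear_order_on X r"
    and mem: "x \<in> X" "p \<in> X" and t: "(t, p) \<in> r" and x: "(x, p) \<notin> r"
  shows "card {y \<in> X. (y, t) \<in> r} < card {y \<in> X. (y, x) \<in> r}"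
proof (rule psubset_card_mono)
  have tr: "trans r" and re: "refl_on X r" and tot: "total_on X r"
    using r by (auto simp: order_on_defs)
  have "(p, x) \<in> r"
    using x mem tot refl_onD[OF re] unfolding total_on_def by metis
  with t have tx: "(t, x) \<in> r"
    using transD[OF tr] by blast
  have "(x, t) \<notin> r"
    using t x transD[OF tr] by blast
  with mem refl_onD[OF re] have "x \<in> {y \<in> X. (y, x) \<in> r}" "x \<notin> {y \<in> X. (y, t) \<in> r}"
    by auto
  moreover have "{y \<in> X. (y, t) \<in> r} \<subseteq> {y \<in> X. (y, x) \<in> r}"
    using tx transD[OF tr] by blast
  ultimately show "{y \<in> X. (y, t) \<in> r} \<subset> {y \<in> X. (y, x) \<in> r}"
    by blast
qed (use X in simp)


section \<open>Free maps\<close>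

text \<open>
  Injectivity is left out so that the induction can start with no orders, where a constant map
  serves; it is recovered afterwards.
\<close>

lemma free_map_exists:
  fixes X :: "'a set" and le :: "nat \<Rightarrow> 'a rel" and K :: "'k set"
  assumes X: "finite X"
    and "\<And>i. i \<in> {1..d} \<Longrightarrow> linear_order_on X (le i)"
    and "above_chain d K"
    and "S \<in> Fpow K \<rightarrow> Fpow K"
  shows "\<exists>u. u ` X \<subseteq> K \<and>
           (\<forall>s x. (\<forall>i\<in>{1..d}. s i \<in> X) \<longrightarrow> x \<in> X - orthant X le d s \<longrightarrow>
                  u x \<notin> S (u ` orthant X le d s))"
  using assms(2-)
proof (induction d arbitrary: K S)
  case 0
  then obtain k where "k \<in> K"
    by auto
  then show ?case
    by (intro exI[of _ "\<lambda>_. k"]) (auto simp: orthant_def)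
next
  case (Suc d)
  obtain L :: "'k set" where K: "infinite K" and chain: "above_chain d L" and L: "|L| <o |K|"
    using Suc.prems(2) by auto
  obtain \<phi> :: "nat \<Rightarrow> 'k \<Rightarrow> 'k" where inj: "\<And>j. inj_on (\<phi> j) L" and sub: "\<And>j. \<phi> j ` L \<subseteq> K"
    and avoid: "\<And>j C. C \<in> Fpow (\<Union>i<j. \<phi> i ` L) \<Longrightarrow> \<phi> j ` L \<inter> S C = {}"
    using avoiding_copies[OF K L Suc.prems(3)] by metis
  define rank where "rank x = card {y \<in> X. (y, x) \<in> le (Suc d)}" for x
  define copies where "copies B = (\<Union>x\<in>X. \<phi> (rank x) ` B)" for B
  define T where "T B = (\<Union>x\<in>X. \<Union>C\<in>Fpow (copies B). {y \<in> L. \<phi> (rank x) y \<in> S C})" for B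

  have "T \<in> Fpow L \<rightarrow> Fpow L"
  proof
    fix B assume B: "B \<in> Fpow L"
    have "finite (copies B)"
      using X B by (auto simp: copies_def Fpow_def)
    then have "finite (Fpow (copies B))"
      by (simp add: finite_subset[OF Fpow_subset_Pow])
    moreover have "finite {y \<in> L. \<phi> (rank x) y \<in> S C}" if C: "C \<in> Fpow (copies B)" for x C
    proof -
      have "copies B \<subseteq> K"
        using B sub by (auto simp: copies_def Fpow_def)
      then have "S C \<in> Fpow K"
        using C Suc.prems(3) Fpow_mono[of "copies B" K] by blast
      then have "finite (\<phi> (rank x) -` S C \<inter> L)"
        using inj by (intro finite_vimage_IntI) (auto simp: Fpow_def)
      then show ?thesis
        by (rule rev_finite_subset) blast
    qed
    ultimately have "finite (T B)"
      using X unfolding T_def by (intro finite_UN_I) auto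
    moreover have "T B \<subseteq> L"
      by (auto simp: T_def)
    ultimately show "T B \<in> Fpow L"
      by (simp add: Fpow_def)
  qed
  moreover have "linear_order_on X (le i)" if "i \<in> {1..d}" for i
    using Suc.prems(1) that by simp
  ultimately obtain v where v: "v ` X \<subseteq> L"
    and free: "\<And>s x. \<lbrakk>\<forall>i\<in>{1..d}. s i \<in> X; x \<in> X - orthant X le d s\<rbrakk>
                 \<Longrightarrow> v x \<notin> T (v ` orthant X le d s)"
    using Suc.IH[OF _ chain, of T] by metis
  define u where "u x = \<phi> (rank x) (v x)" for x
  have u: "u x \<in> \<phi> (rank x) ` L" if "x \<in> X" for x
    using v that by (auto simp: u_def)

  have "u x \<notin> S (u ` orthant X le (Suc d) s)"
    if s: "\<forall>i\<in>{1..Suc d}. s i \<in> X" and x: "x \<in> X - orthant X le (Suc d) s" for s x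
  proof (cases "x \<in> orthant X le d s")
    case True
    \<comment> \<open>\<open>x\<close> lies above the corner in the last order, so \<open>u\<close> maps the orthant into earlier copies.\<close>
    then have notle: "(x, s (Suc d)) \<notin> le (Suc d)"
      using x by (auto simp: orthant_Suc)
    have "u t \<in> (\<Union>i<rank x. \<phi> i ` L)" if t: "t \<in> orthant X le (Suc d) s" for t
    proof -
      have "t \<in> X" "(t, s (Suc d)) \<in> le (Suc d)"
        using t by (auto simp: orthant_def)
      then have "rank t < rank x"
        unfolding rank_def using Suc.prems(1)[of "Suc d"] s x notle
        by (intro linear_order_rank_less[OF X]) auto
      then show ?thesis
        using u[OF \<open>t \<in> X\<close>] by blast
    qed
    moreover have "finite (orthant X le (Suc d) s)"
      using X by (simp add: orthant_def)
    ultimately have "u ` orthant X le (Suc d) s \<in> Fpow (\<Union>i<rank x. \<phi> i ` L)"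
      by (auto simp: Fpow_def)
    then show ?thesis
      using avoid u x by blast
  next
    case False
    \<comment> \<open>The orthant of \<open>d + 1\<close> orders is contained in that of the first \<open>d\<close>, so its image is among the
      finite sets \<open>C\<close> that \<open>T\<close> takes into account.\<close>
    have "u ` orthant X le (Suc d) s \<in> Fpow (copies (v ` orthant X le d s))"
      using X by (auto simp: Fpow_def copies_def u_def orthant_def)
    moreover have "v x \<notin> T (v ` orthant X le d s)"
      using free[of s x] s x False by auto
    moreover have "v x \<in> L" "x \<in> X"
      using v x by auto
    ultimately show ?thesis
      unfolding T_def u_def by blast
  qed
  moreover have "u ` X \<subseteq> K"
    using u sub by blast
  ultimately show ?case
    by (intro exI[of _ u]) blast
qed

text \<open>
  Injectivity comes for free from the function \<open>C \<mapsto> S C \<union> C\<close>: of two different points, one is not in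
  the orthant below the other, hence has an image outside the image of that orthant.
\<close>

lemma has_free_images_orthants:
  fixes X :: "'a set" and le :: "nat \<Rightarrow> 'a rel" and K :: "'k set"
  assumes X: "finite X"
    and lin: "\<And>i. i \<in> {1..Suc d} \<Longrightarrow> linear_order_on X (le i)"
    and chain: "above_chain (Suc d) K"
  shows "has_free_images {orthant X le (Suc d) s | s. \<forall>i\<in>{1..Suc d}. s i \<in> X} K"
  unfolding has_free_images_def
proof
  fix S assume S: "S \<in> Fpow K \<rightarrow> Fpow K"
  let ?\<F> = "{orthant X le (Suc d) s | s. \<forall>i\<in>{1..Suc d}. s i \<in> X}"
  define T where "T C = S C \<union> C" for C
  have T: "T \<in> Fpow K \<rightarrow> Fpow K"
  proof
    fix C assume "C \<in> Fpow K"
    moreover from S this have "S C \<in> Fpow K"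
      by (rule funcset_mem)
    ultimately show "T C \<in> Fpow K"
      by (simp add: Fpow_def T_def)
  qed
  have "\<exists>u. u ` X \<subseteq> K \<and>
      (\<forall>s x. (\<forall>i\<in>{1..Suc d}. s i \<in> X) \<longrightarrow> x \<in> X - orthant X le (Suc d) s \<longrightarrow>
             u x \<notin> T (u ` orthant X le (Suc d) s))"
    using X lin chain T by (rule free_map_exists)
  then obtain u where u: "u ` X \<subseteq> K"
    and "\<forall>s x. (\<forall>i\<in>{1..Suc d}. s i \<in> X) \<longrightarrow> x \<in> X - orthant X le (Suc d) s \<longrightarrow>
               u x \<notin> T (u ` orthant X le (Suc d) s)"
    by (elim exE conjE)
  then have free: "u x \<notin> S (u ` orthant X le (Suc d) s) \<union> u ` orthant X le (Suc d) s"
    if "\<forall>i\<in>{1..Suc d}. s i \<in> X" "x \<in> X - orthant X le (Suc d) s" for s x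
    using that unfolding T_def by blast
  have self: "x \<in> orthant X le (Suc d) (\<lambda>_. x)" if "x \<in> X" for x
  proof -
    have "(x, x) \<in> le i" if "i \<in> {1..Suc d}" for i
      using lin[OF that] \<open>x \<in> X\<close> by (simp add: order_on_defs refl_on_def)
    then show ?thesis
      using \<open>x \<in> X\<close> by (simp add: orthant_def)
  qed
  have inj: "inj_on u X"
  proof (rule inj_onI, rule ccontr)
    fix x y assume xy: "x \<in> X" "y \<in> X" "u x = u y" "x \<noteq> y"
    have sep: "a \<in> orthant X le (Suc d) (\<lambda>_. b)" if "a \<in> X" "b \<in> X" "u a = u b" for a b
      using free[of "\<lambda>_. b" a] self[of b] that by auto
    then have "(x, y) \<in> le 1" "(y, x) \<in> le 1"
      using sep[of x y] sep[of y x] xy by (auto simp: orthant_def)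
    moreover have "antisym (le 1)"
      using lin[of 1] by (auto simp: order_on_defs)
    ultimately show False
      using xy(4) by (auto dest: antisymD)
  qed
  have "\<Union>?\<F> = X"
  proof
    show "\<Union>?\<F> \<subseteq> X"
      by (auto simp: orthant_def)
    show "X \<subseteq> \<Union>?\<F>"
      using self by blast
  qed
  then have "bij_betw u (\<Union>?\<F>) (u ` X)"
    using inj by (simp add: bij_betw_def)
  moreover have "S (u ` A) \<inter> u ` X \<subseteq> u ` A" if A: "A \<in> ?\<F>" for A
  proof -
    obtain s where "A = orthant X le (Suc d) s" "\<forall>i\<in>{1..Suc d}. s i \<in> X"
      using A by blast
    then show ?thesis
      using free[of s] by blast
  qed
  ultimately show "\<exists>Y u. Y \<subseteq> K \<and> bij_betw u (\<Union>?\<F>) Y \<and> (\<forall>A\<in>?\<F>. S (u ` A) \<inter> Y \<subseteq> u ` A)"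
    using u by (intro exI[of _ "u ` X"] exI[of _ u] conjI ballI)
qed

theorem theorem4p1:
  fixes n :: nat and X :: "'a set" and le :: "nat \<Rightarrow> 'a rel" and K :: "'k set"
  assumes "finite X"
    and "\<And>i. i \<in> {1..n + 1} \<Longrightarrow> linear_order_on X (le i)"
    and "aleph_set n K"
  shows "fr TYPE('k)
           {A. A \<subseteq> X \<and> (\<exists>s. (\<forall>i\<in>{1..n + 1}. s i \<in> X) \<and>
                              A = {t \<in> X. \<forall>i\<in>{1..n + 1}. (t, s i) \<in> le i})} \<le> enat n"
proof -
  have "{A. A \<subseteq> X \<and> (\<exists>s. (\<forall>i\<in>{1..n + 1}. s i \<in> X) \<and>
                              A = {t \<in> X. \<forall>i\<in>{1..n + 1}. (t, s i) \<in> le i})}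
        = {orthant X le (Suc n) s | s. \<forall>i\<in>{1..Suc n}. s i \<in> X}"
    by (auto simp: orthant_def)
  moreover have "has_free_images {orthant X le (Suc n) s | s. \<forall>i\<in>{1..Suc n}. s i \<in> X} K"
    using assms aleph_set_imp_above_chain by (intro has_free_images_orthants) auto
  ultimately show ?thesis
    unfolding fr_le_iff using assms(3) by auto
qed

end
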